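(* Suppose that the trust-region subproblem $\min_{\|x\|\le\Delta}\{\frac12 x^TAx+x^Tg\}$ is in easy case. Let $$\eta_1=\frac12\min\left\{\frac{(\alpha_{n-s}-\alpha_n)\big(\|(A-\alpha_nI)^{\dagger}g\|-\Delta\big)}{\frac32\|(A-\alpha_nI)^{\dagger}g\|+1+\frac{\cos\angle(g,\mathcal U_2)\,\|g\|}{\alpha_{n-s}-\alpha_n}},\ \alpha_{n-s}-\alpha_n\right\},$$ $$\eta_2=\frac12\min\left\{\frac{\|U_2U_2^Tg\|(\alpha_{n-s}-\alpha_n)}{4\|g\|+(\alpha_{n-s}-\alpha_n)},\ \frac{\|g\|\cos\angle(g,\mathcal U_2)}{2\Delta},\ \alpha_{n-s}-\alpha_n\right\}.$$ Then the perturbed trust-region subproblem $\min_{\|x\|\le\Delta}\{\frac12 x^T(A+\varepsilon E)x+x^T(g+\varepsilon e)\}$ is also in easy case if $$0<\max\{\|\varepsilon E\|,\|\varepsilon e\|\}<\max\{\eta_1,\eta_2\}.$$ Specifically, if $A$ is positive definite, then the perturbed trust-region subproblem is also in easy case if $0<\|\varepsilon E\|<\alpha_n$.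
   Context: $\|\cdot\|$ is the Euclidean (spectral) norm and $^\dagger$ the Moore–Penrose inverse. $A\in\mathbb R^{n\times n}$ is symmetric, $0\ne g\in\mathbb R^n$, $\Delta>0$; $E\in\mathbb R^{n\times n}$ is symmetric, $e\in\mathbb R^n$, $\varepsilon\in\mathbb R$. The eigenvalues of $A$ are $\alpha_1\ge\cdots\ge\alpha_{n-s}>\alpha_{n-s+1}=\cdots=\alpha_n$, where $1\le s<n$ is the multiplicity of $\alpha_n$. $U_2\in\mathbb R^{n\times s}$ has orthonormal columns spanning the eigenspace $\mathcal U_2$ of $A$ for $\alpha_n$, and $\cos\angle(g,\mathcal U_2)=\|U_2^Tg\|/\|g\|$. Trust-region subproblem (TRS): for symmetric $B\in\mathbb R^{n\times n}$ and $b\in\mathbb R^n$, consider $\min_{\|x\|\le\Delta}\{\frac12x^TBx+x^Tb\}$. A vector $x_*$ with $\|x_*\|\le\Delta$ is a global minimizer iff there is a Lagrange multiplier $\lambda_*\ge0$ with $(B+\lambda_*I)x_*=-b$, $\lambda_*(\Delta-\|x_*\|)=0$ and $B+\lambda_*I$ positive semidefinite. The TRS is in easy case if $\lambda_*>-\beta_n$ (and $\lambda_*\ge0$), where $\beta_n$ is the smallest eigenvalue of $B$, i.e. $B+\lambda_*I$ is positive definite; otherwise ($\lambda_*=-\beta_n$) it is in hard case. *)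

theory Defs
  imports "HOL-Analysis.Analysis"
begin

definition symmetric_mat :: "real^'n^'n \<Rightarrow> bool" where
  "symmetric_mat B \<longleftrightarrow> transpose B = B"

definition pos_semidef_mat :: "real^'n^'n \<Rightarrow> bool" where
  "pos_semidef_mat B \<longleftrightarrow> symmetric_mat B \<and> (\<forall>x. 0 \<le> x \<bullet> (B *v x))"

definition pos_def_mat :: "real^'n^'n \<Rightarrow> bool" where
  "pos_def_mat B \<longleftrightarrow> symmetric_mat B \<and> (\<forall>x. x \<noteq> 0 \<longrightarrow> 0 < x \<bullet> (B *v x))"

definition eigenspace :: "real^'n^'n \<Rightarrow> real \<Rightarrow> (real^'n) set" where
  "eigenspace B \<mu> = {v. B *v v = \<mu> *\<^sub>R v}"

definition eigenvalues :: "real^'n^'n \<Rightarrow> real set" where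
  "eigenvalues B = {\<mu>. \<exists>v \<in> eigenspace B \<mu>. v \<noteq> 0}"

text \<open>Only used for symmetric matrices, whose set of real eigenvalues is finite and nonempty.\<close>
definition min_eigenvalue :: "real^'n^'n \<Rightarrow> real" where
  "min_eigenvalue B = Min (eigenvalues B)"

text \<open>The values \<open>\<alpha> 1 \<ge> \<dots> \<ge> \<alpha> n\<close> are the eigenvalues of \<open>B\<close> counted with multiplicity
  (as roots of the characteristic polynomial), where \<open>n\<close> is the dimension.
  Values of \<open>\<alpha>\<close> outside \<open>{1..n}\<close> are irrelevant.\<close>
definition ordered_eigenvalues :: "real^'n^'n \<Rightarrow> (nat \<Rightarrow> real) \<Rightarrow> bool" where
  "ordered_eigenvalues B \<alpha> \<longleftrightarrow>
     antimono_on {1..CARD('n)} \<alpha> \<and>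
     (\<forall>t. det (mat t - B) = (\<Prod>i = 1..CARD('n). t - \<alpha> i))"

abbreviation spectral_norm :: "real^'n^'m \<Rightarrow> real" where
  "spectral_norm B \<equiv> onorm ((*v) B)"

definition is_moore_penrose :: "real^'n^'m \<Rightarrow> real^'m^'n \<Rightarrow> bool" where
  "is_moore_penrose B X \<longleftrightarrow>
     B ** X ** B = B \<and> X ** B ** X = X \<and>
     symmetric_mat (B ** X) \<and> symmetric_mat (X ** B)"

definition moore_penrose :: "real^'n^'m \<Rightarrow> real^'m^'n" where
  "moore_penrose B = (THE X. is_moore_penrose B X)"

definition orthonormal_basis_mat :: "real^'s^'n \<Rightarrow> (real^'n) set \<Rightarrow> bool" where
  "orthonormal_basis_mat U S \<longleftrightarrow> transpose U ** U = mat 1 \<and> span (columns U) = S"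

text \<open>Cosine of the angle between \<open>g\<close> and the column space of \<open>U\<close>, for \<open>U\<close> with orthonormal
  columns.\<close>
definition cos_angle :: "real^'n \<Rightarrow> real^'s^'n \<Rightarrow> real" where
  "cos_angle g U = norm (transpose U *v g) / norm g"

definition trs_objective :: "real^'n^'n \<Rightarrow> real^'n \<Rightarrow> real^'n \<Rightarrow> real" where
  "trs_objective B b x = 1/2 * (x \<bullet> (B *v x)) + x \<bullet> b"

definition trs_minimizer :: "real^'n^'n \<Rightarrow> real^'n \<Rightarrow> real \<Rightarrow> real^'n \<Rightarrow> bool" where
  "trs_minimizer B b \<Delta> x \<longleftrightarrow> is_arg_min (trs_objective B b) (\<lambda>x. norm x \<le> \<Delta>) x"

definition trs_multiplier :: "real^'n^'n \<Rightarrow> real^'n \<Rightarrow> real \<Rightarrow> real^'n \<Rightarrow> real \<Rightarrow> bool" where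
  "trs_multiplier B b \<Delta> x lam \<longleftrightarrow>
     norm x \<le> \<Delta> \<and> 0 \<le> lam \<and> (B + mat lam) *v x = - b \<and>
     lam * (\<Delta> - norm x) = 0 \<and> pos_semidef_mat (B + mat lam)"

text \<open>By the lemma \<open>trs_multiplier_unique\<close> below, the multiplier is determined by
  the problem, so it does not matter which minimizer is chosen here.\<close>
definition trs_easy_case :: "real^'n^'n \<Rightarrow> real^'n \<Rightarrow> real \<Rightarrow> bool" where
  "trs_easy_case B b \<Delta> \<longleftrightarrow>
     (\<exists>x lam. trs_minimizer B b \<Delta> x \<and> trs_multiplier B b \<Delta> x lam \<and> lam > - min_eigenvalue B)"

lemma mat_mult_vec: "(mat c :: real^'n^'n) *v x = c *\<^sub>R x"
  by (simp add: vec_eq_iff matrix_vector_mult_def mat_def if_distrib if_distribR cong: if_cong)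

lemma trs_multiplier_unique:
  fixes B :: "real^'n^'n"
  assumes "\<Delta> > 0" and 1: "trs_multiplier B b \<Delta> x1 lam1" and 2: "trs_multiplier B b \<Delta> x2 lam2"
  shows "lam1 = lam2"
proof -
  have *: "\<not> l1 < l2" if h1: "trs_multiplier B b \<Delta> y1 l1" and h2: "trs_multiplier B b \<Delta> y2 l2"
    for y1 y2 :: "real^'n" and l1 l2
  proof
    assume less: "l1 < l2"
    have n1: "norm y1 \<le> \<Delta>" and n2: "norm y2 = \<Delta>"
      using h1 h2 less unfolding trs_multiplier_def by auto
    have e1: "B *v y1 + l1 *\<^sub>R y1 = - b" and e2: "B *v y2 + l2 *\<^sub>R y2 = - b"
      using h1 h2 by (auto simp: trs_multiplier_def matrix_vector_mult_add_rdistrib mat_mult_vec)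
    have "B *v (y1 - y2) = l2 *\<^sub>R y2 - l1 *\<^sub>R y1"
      using e1 e2 by (simp add: matrix_vector_mult_diff_distrib algebra_simps)
    then have eq: "(B + mat l1) *v (y1 - y2) = (l2 - l1) *\<^sub>R y2"
      by (simp add: matrix_vector_mult_add_rdistrib mat_mult_vec algebra_simps)
    have "0 \<le> (y1 - y2) \<bullet> ((B + mat l1) *v (y1 - y2))"
      using h1 by (simp add: trs_multiplier_def pos_semidef_mat_def)
    then have "0 \<le> (y1 - y2) \<bullet> y2"
      unfolding eq using less by (simp add: zero_le_mult_iff)
    moreover have "(norm (y1 - y2))\<^sup>2 = (norm y1)\<^sup>2 - (norm y2)\<^sup>2 - 2 * ((y1 - y2) \<bullet> y2)"
      by (simp add: power2_norm_eq_inner inner_diff inner_commute algebra_simps)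
    moreover have "(norm y1)\<^sup>2 \<le> (norm y2)\<^sup>2"
      using n1 n2 by (simp add: power_mono)
    ultimately have "(norm (y1 - y2))\<^sup>2 \<le> 0"
      by linarith
    then have "y1 = y2"
      by simp
    then have "(l2 - l1) *\<^sub>R y2 = 0"
      using eq by simp
    then show False
      using less n2 \<open>\<Delta> > 0\<close> by auto
  qed
  show ?thesis
    using *[OF 1 2] *[OF 2 1] by linarith
qed

end

theory Submission
  imports Defs
begin

text \<open>A global minimizer always has a multiplier \<open>\<lambda> \<ge> - \<beta>\<close>, where \<open>\<beta>\<close> is the smallest eigenvalue of
  the perturbed matrix. So the perturbed problem can only be in the hard case if \<open>\<beta> \<le> 0\<close> and some
  \<open>x\<close> in the ball satisfies \<open>(A + F - \<beta>I) x = - (g + f)\<close>, with \<open>F = \<epsilon>E\<close> and \<open>f = \<epsilon>e\<close>. If \<open>F\<close> and \<open>f\<close>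
  have norm at most \<open>t\<close> and \<open>a\<close> is the smallest eigenvalue of \<open>A\<close>, then \<open>\<bar>\<beta> - a\<bar> \<le> t\<close>, hence
  \<open>(A - aI) x + g\<close> has norm at most \<open>t (2\<Delta> + 1)\<close>. Projecting onto the eigenspace of \<open>a\<close> removes
  \<open>(A - aI) x\<close> and bounds \<open>\<parallel>U\<^sub>2\<^sup>Tg\<parallel>\<close>, contradicting \<open>t < \<eta>\<^sub>2\<close>. Applying the Moore--Penrose inverse,
  whose norm is at most the inverse of the spectral gap, bounds \<open>\<parallel>(A - aI)\<^sup>\<dagger>g\<parallel> - \<Delta>\<close>, contradicting
  \<open>t < \<eta>\<^sub>1\<close>.\<close>

section \<open>Symmetric matrices, the spectral norm and a limit argument\<close>

lemma symmetric_mat_inner: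
  "symmetric_mat B \<Longrightarrow> x \<bullet> (B *v y) = (B *v x) \<bullet> y"
  unfolding symmetric_mat_def by (metis dot_lmul_matrix transpose_matrix_vector)

lemma symmetric_mat_add [intro]:
  "symmetric_mat A \<Longrightarrow> symmetric_mat B \<Longrightarrow> symmetric_mat (A + B)"
  by (simp add: symmetric_mat_def transpose_def vec_eq_iff)

lemma symmetric_mat_diff [intro]:
  "symmetric_mat A \<Longrightarrow> symmetric_mat B \<Longrightarrow> symmetric_mat (A - B)"
  by (simp add: symmetric_mat_def transpose_def vec_eq_iff)

lemma symmetric_mat_scaleR [intro]:
  "symmetric_mat A \<Longrightarrow> symmetric_mat (c *\<^sub>R A)"
  by (simp add: symmetric_mat_def transpose_def vec_eq_iff)

lemma symmetric_mat_mat [simp]: "symmetric_mat (mat c)"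
  by (simp add: symmetric_mat_def)

lemma spectral_norm_bound: "norm (B *v x) \<le> spectral_norm B * norm x"
  for B :: "real^'n^'m"
  by (rule onorm) (rule matrix_vector_mul_bounded_linear)

text \<open>Let \<open>t\<close> tend to 0 from the right. The same limit serves to extract
  first-order conditions along a segment and to reach a critical direction through nearby
  ones.\<close>

lemma quadratic_constant_term_nonneg:
  fixes a b c r :: real
  assumes "r > 0" and nonneg: "\<And>t. 0 < t \<Longrightarrow> t < r \<Longrightarrow> 0 \<le> a + b * t + c * t\<^sup>2"
  shows "0 \<le> a"
proof (rule tendsto_lowerbound)
  have "((\<lambda>t. a + b * t + c * t\<^sup>2) \<longlongrightarrow> a + b * 0 + c * 0\<^sup>2) (at_right 0)"
    by (intro tendsto_intros)
  then show "((\<lambda>t. a + b * t + c * t\<^sup>2) \<longlongrightarrow> a) (at_right 0)"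
    by simp
  show "\<forall>\<^sub>F t in at_right 0. 0 \<le> a + b * t + c * t\<^sup>2"
    unfolding eventually_at_right_field using assms by blast
qed simp

section \<open>Extreme eigenvalues\<close>

text \<open>Minimise the quadratic form over the compact unit sphere of \<open>S\<close>. The
  residual \<open>w = B *v v - \<mu> *\<^sub>R v\<close> at a minimiser \<open>v\<close> stays in
  \<open>S\<close> by invariance, and a move from \<open>v\<close> along \<open>-w\<close> would
  lower the Rayleigh quotient unless \<open>w = 0\<close>. Applied to the whole space it gives the
  smallest eigenvalue; applied to the orthogonal complement of an eigenspace, the spectral
  gap.\<close>

lemma rayleigh_minimum_on_invariant_subspace:
  fixes B :: "real^'n^'n"
  assumes B: "symmetric_mat B" and S: "subspace S" "S \<noteq> {0}"
    and inv: "\<And>v. v \<in> S \<Longrightarrow> B *v v \<in> S"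
  obtains v \<mu> where "v \<in> S" "v \<noteq> 0" "B *v v = \<mu> *\<^sub>R v"
    "\<And>x. x \<in> S \<Longrightarrow> \<mu> * (x \<bullet> x) \<le> x \<bullet> (B *v x)"
proof -
  let ?K = "sphere 0 1 \<inter> S"
  have "compact ?K"
    by (intro compact_Int_closed compact_sphere closed_subspace S)
  moreover obtain u where u: "u \<in> S" "u \<noteq> 0"
    using S subspace_0 by blast
  then have "u /\<^sub>R norm u \<in> ?K"
    using S by (simp add: subspace_scale)
  then have "?K \<noteq> {}"
    by blast
  moreover have "continuous_on ?K (\<lambda>x. x \<bullet> (B *v x))"
    by (intro continuous_intros linear_continuous_on matrix_vector_mul_bounded_linear)
  ultimately obtain v where v: "v \<in> ?K" and min: "\<forall>y\<in>?K. v \<bullet> (B *v v) \<le> y \<bullet> (B *v y)"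
    using continuous_attains_inf by blast
  define \<mu> where "\<mu> = v \<bullet> (B *v v)"
  have vv: "v \<bullet> v = 1"
    using v by (simp add: norm_eq_1)
  have ray: "\<mu> * (x \<bullet> x) \<le> x \<bullet> (B *v x)" if "x \<in> S" for x
  proof (cases "x = 0")
    case False
    then have "x /\<^sub>R norm x \<in> ?K"
      using that S by (simp add: subspace_scale)
    then have "\<mu> \<le> (x /\<^sub>R norm x) \<bullet> (B *v (x /\<^sub>R norm x))"
      using min \<mu>_def by blast
    also have "\<dots> = (x \<bullet> (B *v x)) / (x \<bullet> x)"
      by (simp add: matrix_vector_mult_scaleR dot_square_norm power2_eq_square divide_simps)
    finally show ?thesis
      using False by (simp add: field_simps)
  qed simp
  define w where "w = B *v v - \<mu> *\<^sub>R v"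
  have wS: "w \<in> S"
    unfolding w_def using v S inv by (intro subspace_diff subspace_scale) auto
  have wv: "w \<bullet> v = 0"
    unfolding w_def \<mu>_def by (simp add: inner_diff_left vv) (simp add: inner_commute)
  have wBv: "w \<bullet> (B *v v) = w \<bullet> w"
    using wv unfolding w_def by (simp add: inner_diff_right)
  \<comment> \<open>This is \<open>ray\<close> at \<open>v - t *\<^sub>R w\<close>, divided by
    \<open>t\<close>. Its limit for small \<open>t\<close> forces \<open>w = 0\<close>.\<close>
  have "0 \<le> - (2 * (w \<bullet> w)) + (w \<bullet> (B *v w) - \<mu> * (w \<bullet> w)) * t + 0 * t\<^sup>2"
    if "0 < t" for t
  proof -
    let ?y = "v - t *\<^sub>R w"
    have "?y \<in> S"
      using v S wS by (intro subspace_diff subspace_scale) auto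
    from ray[OF this]
    have "0 \<le> ?y \<bullet> (B *v ?y) - \<mu> * (?y \<bullet> ?y)"
      by simp
    also have "?y \<bullet> (B *v ?y) = \<mu> - 2 * t * (w \<bullet> w) + t\<^sup>2 * (w \<bullet> (B *v w))"
      using wBv symmetric_mat_inner[OF B, of v w]
      by (simp add: matrix_vector_mult_diff_distrib matrix_vector_mult_scaleR inner_diff_left
          inner_diff_right \<mu>_def[symmetric] inner_commute algebra_simps power2_eq_square)
    also have "?y \<bullet> ?y = 1 + t\<^sup>2 * (w \<bullet> w)"
      using wv vv by (simp add: inner_diff_left inner_diff_right inner_commute algebra_simps
          power2_eq_square)
    finally have "0 \<le> t * (- (2 * (w \<bullet> w)) + (w \<bullet> (B *v w) - \<mu> * (w \<bullet> w)) * t)"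
      by (simp add: algebra_simps power2_eq_square)
    with that show ?thesis
      by (simp add: zero_le_mult_iff)
  qed
  then have "0 \<le> - (2 * (w \<bullet> w))"
    by (rule quadratic_constant_term_nonneg[OF zero_less_one])
  then have "w = 0"
    using inner_gt_zero_iff[of w] by linarith
  moreover have "v \<noteq> 0"
    using vv by auto
  ultimately show thesis
    using that[of v \<mu>] v ray unfolding w_def by auto
qed

text \<open>Eigenvectors for distinct eigenvalues are orthogonal, hence independent, so one choice
  per eigenvalue gives a finite set. Finiteness is what makes \<open>Min\<close> in
  \<open>min_eigenvalue\<close> meaningful.\<close>

lemma finite_eigenvalues:
  assumes B: "symmetric_mat B"
  shows "finite (eigenvalues B)"
proof -
  have "\<forall>\<mu>\<in>eigenvalues B. \<exists>v. B *v v = \<mu> *\<^sub>R v \<and> v \<noteq> 0"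
    by (auto simp: eigenvalues_def eigenspace_def)
  then obtain v where v: "\<And>\<mu>. \<mu> \<in> eigenvalues B \<Longrightarrow> B *v v \<mu> = \<mu> *\<^sub>R v \<mu> \<and> v \<mu> \<noteq> 0"
    by metis
  have orth: "v \<mu> \<bullet> v \<nu> = 0" if "\<mu> \<in> eigenvalues B" "\<nu> \<in> eigenvalues B" "\<mu> \<noteq> \<nu>" for \<mu> \<nu>
    using symmetric_mat_inner[OF B, of "v \<mu>" "v \<nu>"] v that by auto
  have "pairwise orthogonal (v ` eigenvalues B)"
    by (auto simp: pairwise_def orthogonal_def intro!: orth)
  moreover have "0 \<notin> v ` eigenvalues B"
    using v by (metis imageE)
  ultimately have "finite (v ` eigenvalues B)"
    using pairwise_orthogonal_independent independent_imp_finite by blast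
  moreover have "inj_on v (eigenvalues B)"
  proof (rule inj_onI, rule ccontr)
    fix \<mu> \<nu> assume *: "\<mu> \<in> eigenvalues B" "\<nu> \<in> eigenvalues B" "v \<mu> = v \<nu>" "\<mu> \<noteq> \<nu>"
    from orth[OF *(1,2,4)] *(3) v[OF *(2)] show False
      by simp
  qed
  ultimately show ?thesis
    by (rule finite_imageD)
qed

text \<open>The Rayleigh minimum over the whole space is itself an eigenvalue, and testing it on
  other eigenvectors shows that it lies below every other one.\<close>

lemma min_eigenvalue_symmetric:
  fixes B :: "real^'n^'n"
  assumes B: "symmetric_mat B"
  shows min_eigenvalue_in: "min_eigenvalue B \<in> eigenvalues B"
    and min_eigenvalue_rayleigh: "min_eigenvalue B * (x \<bullet> x) \<le> x \<bullet> (B *v x)"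
proof -
  have "(axis undefined 1 :: real^'n) \<noteq> 0"
    by (simp add: axis_eq_0_iff)
  then have "(UNIV :: (real^'n) set) \<noteq> {0}"
    by blast
  then obtain v \<mu> where v: "v \<noteq> 0" "B *v v = \<mu> *\<^sub>R v"
    and ray: "\<And>x. \<mu> * (x \<bullet> x) \<le> x \<bullet> (B *v x)"
    using rayleigh_minimum_on_invariant_subspace[OF B, of UNIV] by auto
  have mem: "\<mu> \<in> eigenvalues B"
    using v by (auto simp: eigenvalues_def eigenspace_def)
  have "\<mu> \<le> \<nu>" if \<nu>: "\<nu> \<in> eigenvalues B" for \<nu>
  proof -
    obtain u where "B *v u = \<nu> *\<^sub>R u" "u \<noteq> 0"
      using \<nu> by (auto simp: eigenvalues_def eigenspace_def)
    with ray[of u] show ?thesis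
      by simp
  qed
  then have "min_eigenvalue B = \<mu>"
    unfolding min_eigenvalue_def by (intro Min_eqI finite_eigenvalues B mem)
  with mem ray show "min_eigenvalue B \<in> eigenvalues B"
    "min_eigenvalue B * (x \<bullet> x) \<le> x \<bullet> (B *v x)"
    by auto
qed

text \<open>Links the definition through eigenvectors to the characteristic polynomial used by
  \<open>ordered_eigenvalues\<close>: a square matrix is singular iff its kernel is
  nontrivial.\<close>

lemma eigenvalues_eq_det_roots:
  "eigenvalues B = {\<mu>. det (mat \<mu> - B) = 0}"
proof -
  have "det (mat \<mu> - B) = 0 \<longleftrightarrow> (\<exists>v. v \<noteq> 0 \<and> (mat \<mu> - B) *v v = 0)" for \<mu>
    by (metis invertible_det_nz invertible_left_inverse matrix_left_invertible_ker)
  moreover have "(mat \<mu> - B) *v v = 0 \<longleftrightarrow> B *v v = \<mu> *\<^sub>R v" for \<mu> v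
    by (auto simp: matrix_vector_mult_diff_rdistrib mat_mult_vec)
  ultimately show ?thesis
    by (auto simp: eigenvalues_def eigenspace_def)
qed

lemma eigenvalues_eq_ordered_eigenvalues:
  fixes B :: "real^'n^'n"
  assumes "ordered_eigenvalues B \<alpha>"
  shows "eigenvalues B = \<alpha> ` {1..CARD('n)}"
  using assms unfolding eigenvalues_eq_det_roots ordered_eigenvalues_def by auto

lemma min_eigenvalue_ordered_eigenvalues:
  fixes B :: "real^'n^'n"
  assumes "ordered_eigenvalues B \<alpha>"
  shows "min_eigenvalue B = \<alpha> CARD('n)"
proof -
  have "1 \<le> CARD('n)"
    by (simp add: Suc_leI)
  moreover from assms have "\<alpha> CARD('n) \<le> \<alpha> i" if "i \<in> {1..CARD('n)}" for i
    using that unfolding ordered_eigenvalues_def monotone_on_def by auto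
  ultimately show ?thesis
    unfolding min_eigenvalue_def eigenvalues_eq_ordered_eigenvalues[OF assms]
    by (intro Min_eqI) auto
qed

text \<open>One half of Weyl's inequality: test the Rayleigh bound of \<open>A\<close> on a bottom
  eigenvector of \<open>A + F\<close> and estimate the contribution of \<open>F\<close> by
  Cauchy-Schwarz.\<close>

lemma min_eigenvalue_add_spectral_norm:
  fixes A F :: "real^'n^'n"
  assumes A: "symmetric_mat A" and F: "symmetric_mat F"
  shows "min_eigenvalue A - spectral_norm F \<le> min_eigenvalue (A + F)"
proof -
  obtain v where v: "(A + F) *v v = min_eigenvalue (A + F) *\<^sub>R v" "v \<noteq> 0"
    using min_eigenvalue_in[of "A + F"] A F by (auto simp: eigenvalues_def eigenspace_def)
  have "\<bar>v \<bullet> (F *v v)\<bar> \<le> norm v * norm (F *v v)"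
    by (rule Cauchy_Schwarz_ineq2)
  also have "\<dots> \<le> norm v * (spectral_norm F * norm v)"
    by (intro mult_left_mono spectral_norm_bound) simp
  finally have "- (spectral_norm F * (v \<bullet> v)) \<le> v \<bullet> (F *v v)"
    by (simp add: dot_square_norm power2_eq_square algebra_simps)
  with min_eigenvalue_rayleigh[OF A, of v]
  have "(min_eigenvalue A - spectral_norm F) * (v \<bullet> v) \<le> v \<bullet> ((A + F) *v v)"
    by (simp add: matrix_vector_mult_add_rdistrib inner_add_right algebra_simps)
  with v show ?thesis
    by simp
qed

text \<open>The other half of Weyl's inequality comes from regarding \<open>A\<close> as
  \<open>A + F\<close> perturbed by \<open>- F\<close>.\<close>

lemma min_eigenvalue_perturbation:
  fixes A F :: "real^'n^'n"
  assumes A: "symmetric_mat A" and F: "symmetric_mat F"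
  shows "\<bar>min_eigenvalue (A + F) - min_eigenvalue A\<bar> \<le> spectral_norm F"
proof -
  have "symmetric_mat (- F)"
    using symmetric_mat_scaleR[OF F, of "-1"] by simp
  moreover have "(*v) (- F) = (\<lambda>x. - (F *v x))"
    using matrix_vector_mult_diff_rdistrib[of 0 F] by (simp add: fun_eq_iff)
  then have "spectral_norm (- F) = spectral_norm F"
    by (simp only: onorm_neg)
  ultimately show ?thesis
    using min_eigenvalue_add_spectral_norm[OF A F]
      min_eigenvalue_add_spectral_norm[of "A + F" "- F"] symmetric_mat_add[OF A F]
    by (simp add: abs_le_iff)
qed

text \<open>By symmetry \<open>A\<close> preserves the orthogonal complement of the eigenspace, so
  the Rayleigh minimum there is an eigenvalue different from \<open>a\<close>, hence at least
  \<open>a + \<delta>\<close>. Cauchy-Schwarz turns this into a bound on norms.\<close>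

lemma norm_ge_gap_on_orthogonal_complement:
  fixes A :: "real^'n^'n"
  assumes A: "symmetric_mat A"
    and gap: "\<And>\<mu>. \<mu> \<in> eigenvalues A \<Longrightarrow> \<mu> \<noteq> a \<Longrightarrow> a + \<delta> \<le> \<mu>"
    and z: "\<And>v. v \<in> eigenspace A a \<Longrightarrow> v \<bullet> z = 0"
  shows "\<delta> * norm z \<le> norm ((A - mat a) *v z)"
proof (cases "z = 0")
  case False
  let ?S = "{x. \<forall>v \<in> eigenspace A a. v \<bullet> x = 0}"
  have "subspace ?S"
    by (auto simp: subspace_def inner_add_right)
  moreover have "z \<in> ?S"
    using z by blast
  moreover have "A *v x \<in> ?S" if "x \<in> ?S" for x
    using that by (auto simp: symmetric_mat_inner[OF A] eigenspace_def)
  ultimately obtain v \<mu> where v: "v \<in> ?S" "v \<noteq> 0" "A *v v = \<mu> *\<^sub>R v"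
    and ray: "\<And>x. x \<in> ?S \<Longrightarrow> \<mu> * (x \<bullet> x) \<le> x \<bullet> (A *v x)"
    using rayleigh_minimum_on_invariant_subspace[OF A, of ?S] False by blast
  \<comment> \<open>Otherwise \<open>v\<close> would be orthogonal to itself.\<close>
  have "v \<notin> eigenspace A a"
    using v by auto
  then have "\<mu> \<noteq> a"
    using v by (auto simp: eigenspace_def)
  moreover have "\<mu> \<in> eigenvalues A"
    using v by (auto simp: eigenvalues_def eigenspace_def)
  ultimately have "a + \<delta> \<le> \<mu>"
    by (rule gap[rotated])
  then have "(a + \<delta>) * (z \<bullet> z) \<le> \<mu> * (z \<bullet> z)"
    by (intro mult_right_mono) auto
  also have "\<dots> \<le> z \<bullet> (A *v z)"
    using ray \<open>z \<in> ?S\<close> by blast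
  finally have "\<delta> * (z \<bullet> z) \<le> z \<bullet> ((A - mat a) *v z)"
    by (simp add: matrix_vector_mult_diff_rdistrib mat_mult_vec inner_diff_right algebra_simps)
  also have "\<dots> \<le> norm z * norm ((A - mat a) *v z)"
    by (rule norm_cauchy_schwarz)
  finally show ?thesis
    using False by (simp add: dot_square_norm power2_eq_square mult.left_commute)
qed simp

section \<open>The Moore--Penrose inverse\<close>

lemma matrix_add_rdistrib: "(A + B) ** C = A ** C + B ** C" for A B :: "real^'n^'m"
  by (simp add: matrix_matrix_mult_def vec_eq_iff sum.distrib distrib_right)

lemma matrix_diff_rdistrib: "(A - B) ** C = A ** C - B ** C" for A B :: "real^'n^'m"
  by (simp add: matrix_matrix_mult_def vec_eq_iff sum_subtractf left_diff_distrib)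

lemma matrix_diff_ldistrib: "A ** (B - C) = A ** B - A ** C" for A :: "real^'n^'m"
  by (simp add: matrix_matrix_mult_def vec_eq_iff sum_subtractf right_diff_distrib)

text \<open>\<open>B ** X\<close> and \<open>B ** Y\<close> are both the orthogonal projection onto
  the range of \<open>B\<close>. Each absorbs the other and transposition swaps the factors, so they
  agree; likewise \<open>X ** B = Y ** B\<close>.\<close>

lemma is_moore_penrose_unique:
  assumes X: "is_moore_penrose B X" and Y: "is_moore_penrose B Y"
  shows "X = Y"
proof -
  note tr = matrix_transpose_mul
  have BX: "B ** X = B ** Y"
  proof -
    have "B ** X = transpose ((B ** Y) ** (B ** X))"
      using X Y unfolding is_moore_penrose_def symmetric_mat_def by (metis matrix_mul_assoc)
    also have "\<dots> = (B ** X) ** (B ** Y)"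
      using X Y unfolding is_moore_penrose_def symmetric_mat_def by (simp only: tr)
    also have "\<dots> = B ** Y"
      using X unfolding is_moore_penrose_def by (metis matrix_mul_assoc)
    finally show ?thesis .
  qed
  have XB: "X ** B = Y ** B"
  proof -
    have "X ** B = transpose ((X ** B) ** (Y ** B))"
      using X Y unfolding is_moore_penrose_def symmetric_mat_def by (metis matrix_mul_assoc)
    also have "\<dots> = (Y ** B) ** (X ** B)"
      using X Y unfolding is_moore_penrose_def symmetric_mat_def by (simp only: tr)
    also have "\<dots> = Y ** B"
      using X unfolding is_moore_penrose_def by (metis matrix_mul_assoc)
    finally show ?thesis .
  qed
  have "X = X ** (B ** X)"
    using X unfolding is_moore_penrose_def by (metis matrix_mul_assoc)
  also have "\<dots> = Y ** B ** Y"
    by (metis BX XB matrix_mul_assoc)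
  also have "\<dots> = Y"
    using Y unfolding is_moore_penrose_def by blast
  finally show ?thesis .
qed

lemma matrix_mult_columns_in_eigenspace:
  fixes U :: "real^'s^'n"
  assumes "columns U \<subseteq> eigenspace B \<mu>"
  shows "B ** U = \<mu> *\<^sub>R U"
proof -
  have "column j (B ** U) = column j (\<mu> *\<^sub>R U)" for j
  proof -
    have "column j (B ** U) = B *v column j U"
      by (simp add: vec_eq_iff column_def matrix_matrix_mult_def matrix_vector_mult_def)
    also have "\<dots> = \<mu> *\<^sub>R column j U"
      using assms by (auto simp: columns_def eigenspace_def)
    finally show ?thesis
      by (simp add: vec_eq_iff column_def)
  qed
  then show ?thesis
    by (simp add: vec_eq_iff column_def)
qed

lemma orthonormal_basis_mat_eigenspace:
  assumes "orthonormal_basis_mat U (eigenspace B \<mu>)"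
  shows "B ** U = \<mu> *\<^sub>R U"
  using assms span_superset unfolding orthonormal_basis_mat_def
  by (intro matrix_mult_columns_in_eigenspace) blast

lemma norm_orthonormal_mult:
  fixes U :: "real^'s^'n"
  assumes "transpose U ** U = mat 1"
  shows "norm (U *v y) = norm y"
proof -
  have "(U *v y) \<bullet> (U *v y) = y \<bullet> ((transpose U ** U) *v y)"
    by (metis dot_lmul_matrix matrix_vector_mul_assoc transpose_matrix_vector inner_commute)
  then show ?thesis
    by (simp add: assms norm_eq_sqrt_inner)
qed

text \<open>Orthogonal projections are contractions. The cases of interest are
  \<open>U ** transpose U\<close> and the two products of a matrix with its Moore-Penrose
  inverse.\<close>

lemma norm_symmetric_idempotent_le:
  assumes P: "symmetric_mat P" "P ** P = P"
  shows "norm (P *v x) \<le> norm x"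
proof -
  have "(norm (P *v x))\<^sup>2 = x \<bullet> (P *v x)"
    by (metis P symmetric_mat_inner matrix_vector_mul_assoc power2_norm_eq_inner)
  also have "\<dots> \<le> norm x * norm (P *v x)"
    by (rule norm_cauchy_schwarz)
  finally show ?thesis
    by (cases "P *v x = 0") (auto simp: power2_eq_square)
qed

lemma norm_transpose_orthonormal_mult_le:
  fixes U :: "real^'s^'n"
  assumes U: "transpose U ** U = mat 1"
  shows "norm (transpose U *v x) \<le> norm x"
proof -
  have "symmetric_mat (U ** transpose U)"
    by (simp add: symmetric_mat_def matrix_transpose_mul)
  moreover have "(U ** transpose U) ** (U ** transpose U) = U ** transpose U"
    by (metis U matrix_mul_assoc matrix_mul_rid)
  ultimately have "norm (U *v (transpose U *v x)) \<le> norm x"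
    by (metis norm_symmetric_idempotent_le matrix_vector_mul_assoc)
  then show ?thesis
    by (simp only: norm_orthonormal_mult[OF U])
qed

lemma orthonormal_basis_mat_projection:
  fixes U :: "real^'s^'n"
  assumes U: "orthonormal_basis_mat U S" and x: "x \<in> S"
  shows "(U ** transpose U) *v x = x"
proof -
  have "x \<in> span (columns U)"
    using U x by (simp add: orthonormal_basis_mat_def)
  also have "span (columns U) \<subseteq> range ((*v) U)"
  proof (rule span_minimal)
    show "columns U \<subseteq> range ((*v) U)"
      by (auto simp: columns_def) (metis matrix_vector_mult_basis rangeI)
    show "subspace (range ((*v) U))"
      by (intro linear_subspace_image) auto
  qed
  finally obtain y where "x = U *v y"
    by blast
  then show ?thesis
    using U unfolding orthonormal_basis_mat_def
    by (metis matrix_vector_mul_assoc matrix_mul_assoc matrix_mul_rid)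
qed

text \<open>With \<open>P\<close> the orthogonal projection onto the kernel of the symmetric matrix \<open>M\<close>,
  the matrix \<open>M + P\<close> is invertible and \<open>(M + P)\<^sup>-\<^sup>1 - P\<close> is the Moore--Penrose inverse.\<close>
lemma is_moore_penrose_moore_penrose:
  fixes M :: "real^'n^'n" and U :: "real^'s^'n"
  assumes M: "symmetric_mat M" and U: "orthonormal_basis_mat U (eigenspace M 0)"
  shows "is_moore_penrose M (moore_penrose M)"
proof -
  define P where "P = U ** transpose U"
  have UU: "transpose U ** U = mat 1"
    using U by (simp add: orthonormal_basis_mat_def)
  have Psym: "transpose P = P"
    by (simp add: P_def matrix_transpose_mul)
  have PP: "P ** P = P"
    unfolding P_def by (metis UU matrix_mul_assoc matrix_mul_rid)
  have MP: "M ** P = 0"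
    unfolding P_def matrix_mul_assoc orthonormal_basis_mat_eigenspace[OF U] by simp
  then have PM: "P ** M = 0"
    using M Psym matrix_transpose_mul[of M P]
    by (simp add: symmetric_mat_def) (simp add: transpose_def vec_eq_iff)
  define K where "K = M + P"
  \<comment> \<open>Multiplying by \<open>P\<close> removes \<open>M\<close> and gives
    \<open>P *v x = 0\<close>. Then \<open>M *v x = 0\<close> as well, and on the kernel of
    \<open>M\<close> the projection \<open>P\<close> is the identity.\<close>
  have Kinj: "x = 0" if "K *v x = 0" for x
  proof -
    have "P *v x = (P ** K) *v x"
      unfolding K_def by (simp add: matrix_add_ldistrib PM PP)
    then have Px: "P *v x = 0"
      using that by (simp add: matrix_vector_mul_assoc[symmetric])
    then have "x \<in> eigenspace M 0"
      using that by (simp add: K_def matrix_vector_mult_add_rdistrib eigenspace_def)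
    then show ?thesis
      using orthonormal_basis_mat_projection[OF U] Px by (simp add: P_def)
  qed
  then obtain L where LK: "L ** K = mat 1"
    using matrix_left_invertible_ker by blast
  then have KL: "K ** L = mat 1"
    by (simp add: matrix_left_right_inverse)
  have PL: "P ** L = P"
  proof -
    have "P ** K = P"
      unfolding K_def by (simp add: matrix_add_ldistrib PM PP)
    then show ?thesis
      by (metis KL matrix_mul_assoc matrix_mul_rid)
  qed
  have LP: "L ** P = P"
  proof -
    have "K ** P = P"
      unfolding K_def by (simp add: matrix_add_rdistrib MP PP)
    then show ?thesis
      by (metis LK matrix_mul_assoc matrix_mul_lid)
  qed
  let ?X = "L - P"
  have "M ** L = mat 1 - P"
    using KL PL unfolding K_def by (simp add: matrix_add_rdistrib algebra_simps)
  then have MX: "M ** ?X = mat 1 - P"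
    using MP by (simp add: matrix_diff_ldistrib)
  have "L ** M = mat 1 - P"
    using LK LP unfolding K_def by (simp add: matrix_add_ldistrib algebra_simps)
  then have XM: "?X ** M = mat 1 - P"
    using PM by (simp add: matrix_diff_rdistrib)
  have "is_moore_penrose M ?X"
    unfolding is_moore_penrose_def MX XM
    using Psym
    by (auto simp: matrix_diff_rdistrib matrix_diff_ldistrib PM PL PP symmetric_mat_def[of P])
  then show ?thesis
    unfolding moore_penrose_def using is_moore_penrose_unique by (metis theI)
qed

section \<open>The trust-region subproblem\<close>

lemma trs_objective_add:
  assumes "symmetric_mat B"
  shows "trs_objective B b (x + d)
    = trs_objective B b x + (B *v x + b) \<bullet> d + 1/2 * (d \<bullet> (B *v d))"
  using symmetric_mat_inner[OF assms, of x d]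
  by (simp add: trs_objective_def matrix_vector_right_distrib inner_add_left inner_add_right
      inner_commute field_simps)

lemma trs_minimizer_exists:
  assumes "\<Delta> > 0"
  obtains x where "trs_minimizer B b \<Delta> x"
proof -
  have "continuous_on (cball 0 \<Delta>) (trs_objective B b)"
    unfolding trs_objective_def
    by (intro continuous_intros linear_continuous_on matrix_vector_mul_bounded_linear)
  then obtain x where "x \<in> cball 0 \<Delta>" "\<forall>y\<in>cball 0 \<Delta>. trs_objective B b x \<le> trs_objective B b y"
    using continuous_attains_inf[OF compact_cball] assms by (metis cball_eq_empty less_asym)
  then show thesis
    using that[of x] by (auto simp: trs_minimizer_def is_arg_min_linorder)
qed

text \<open>From an interior point every short step stays in the ball. Otherwise the squared norm
  changes by \<open>t * (2 * (x \<bullet> d) + t * (d \<bullet> d))\<close>, which is negative up to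
  the explicit bound on \<open>t\<close>.\<close>

lemma descent_direction_feasible:
  fixes x d :: "'a::real_inner"
  assumes "norm x \<le> \<Delta>" and "norm x < \<Delta> \<or> x \<bullet> d < 0"
  obtains r where "r > 0" "\<And>t. 0 < t \<Longrightarrow> t < r \<Longrightarrow> norm (x + t *\<^sub>R d) \<le> \<Delta>"
proof (cases "norm x < \<Delta>")
  case True
  show thesis
  proof (rule that)
    \<comment> \<open>The added 1 keeps the radius positive for \<open>d = 0\<close>, where division
      by zero would yield 0.\<close>
    show "(\<Delta> - norm x) / (norm d + 1) > 0"
      using True by (simp add: add_nonneg_pos)
    fix t assume t: "0 < t" "t < (\<Delta> - norm x) / (norm d + 1)"
    have "norm d + 1 > 0"
      by (simp add: add_nonneg_pos)
    with t have "t * norm d + t < \<Delta> - norm x"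
      by (simp add: pos_less_divide_eq distrib_left)
    moreover have "norm (x + t *\<^sub>R d) \<le> norm x + t * norm d"
      using norm_triangle_ineq[of x "t *\<^sub>R d"] t by simp
    ultimately show "norm (x + t *\<^sub>R d) \<le> \<Delta>"
      using t by linarith
  qed
next
  case False
  then have xd: "x \<bullet> d < 0"
    using assms by blast
  then have dd: "d \<bullet> d > 0"
    by auto
  show thesis
  proof (rule that)
    show "- (2 * (x \<bullet> d)) / (d \<bullet> d) > 0"
      using xd dd by (simp add: divide_neg_pos)
    fix t assume t: "0 < t" "t < - (2 * (x \<bullet> d)) / (d \<bullet> d)"
    then have "t * (d \<bullet> d) < - (2 * (x \<bullet> d)) / (d \<bullet> d) * (d \<bullet> d)"
      by (intro mult_strict_right_mono dd)
    also have "\<dots> = - (2 * (x \<bullet> d))"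
      using dd by simp
    finally have "t * (d \<bullet> d) < - (2 * (x \<bullet> d))" .
    then have "t * (2 * (x \<bullet> d) + t * (d \<bullet> d)) \<le> 0"
      using t by (simp add: mult_nonneg_nonpos)
    then have "(norm (x + t *\<^sub>R d))\<^sup>2 \<le> (norm x)\<^sup>2"
      by (simp add: power2_norm_eq_inner inner_add_left inner_add_right inner_commute
          algebra_simps)
    then have "norm (x + t *\<^sub>R d) \<le> norm x"
      by (simp add: power2_le_iff_abs_le)
    with assms show "norm (x + t *\<^sub>R d) \<le> \<Delta>"
      by linarith
  qed
qed

lemma trs_minimizer_first_order:
  fixes B :: "real^'n^'n"
  assumes B: "symmetric_mat B" and min: "trs_minimizer B b \<Delta> x"
    and d: "norm x < \<Delta> \<or> x \<bullet> d < 0"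
  shows "0 \<le> (B *v x + b) \<bullet> d"
proof -
  have x: "norm x \<le> \<Delta>"
    using min by (simp add: trs_minimizer_def is_arg_min_linorder)
  obtain r where r: "r > 0" "\<And>t. 0 < t \<Longrightarrow> t < r \<Longrightarrow> norm (x + t *\<^sub>R d) \<le> \<Delta>"
    using descent_direction_feasible[OF x d] by blast
  show ?thesis
  proof (rule quadratic_constant_term_nonneg[OF r(1), of _ "1/2 * (d \<bullet> (B *v d))" 0])
    fix t assume t: "0 < t" "t < r"
    then have "trs_objective B b x \<le> trs_objective B b (x + t *\<^sub>R d)"
      using min r(2) by (simp add: trs_minimizer_def is_arg_min_linorder)
    then have "0 \<le> t * ((B *v x + b) \<bullet> d + 1/2 * (d \<bullet> (B *v d)) * t)"
      unfolding trs_objective_add[OF B]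
      by (simp add: matrix_vector_mult_scaleR algebra_simps)
    with t show "0 \<le> (B *v x + b) \<bullet> d + 1/2 * (d \<bullet> (B *v d)) * t + 0 * t\<^sup>2"
      by (simp add: zero_le_mult_iff)
  qed
qed

text \<open>The first-order condition along the negative gradient makes the gradient vanish; the
  exact quadratic expansion then shows that \<open>B\<close> is positive semidefinite.\<close>

lemma trs_minimizer_interior_multiplier:
  fixes B :: "real^'n^'n"
  assumes B: "symmetric_mat B" and min: "trs_minimizer B b \<Delta> x" and x: "norm x < \<Delta>"
  shows "trs_multiplier B b \<Delta> x 0"
proof -
  have "0 \<le> (B *v x + b) \<bullet> (- (B *v x + b))"
    by (rule trs_minimizer_first_order[OF B min]) (simp add: x)
  then have G: "B *v x + b = 0"
    using inner_gt_zero_iff[of "B *v x + b"] by (simp only: inner_minus_right) linarith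
  have "0 \<le> d \<bullet> (B *v d)" for d
  proof -
    obtain r where r: "r > 0" "\<And>t. 0 < t \<Longrightarrow> t < r \<Longrightarrow> norm (x + t *\<^sub>R d) \<le> \<Delta>"
      using descent_direction_feasible[of x \<Delta> d] x by auto
    then have "norm (x + (r/2) *\<^sub>R d) \<le> \<Delta>"
      by simp
    then have "trs_objective B b x \<le> trs_objective B b (x + (r/2) *\<^sub>R d)"
      using min by (simp add: trs_minimizer_def is_arg_min_linorder)
    then show ?thesis
      unfolding trs_objective_add[OF B] G
      using \<open>r > 0\<close> by (simp add: matrix_vector_mult_scaleR zero_le_mult_iff)
  qed
  moreover have "B *v x = - b"
    using G by (simp add: eq_neg_iff_add_eq_0)
  ultimately show ?thesis
    using x B by (auto simp: trs_multiplier_def pos_semidef_mat_def matrix_vector_mult_add_rdistrib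
        mat_mult_vec)
qed

text \<open>The candidate \<open>lam\<close> makes \<open>w = G + lam *\<^sub>R x\<close> orthogonal
  to \<open>x\<close>, where \<open>G\<close> is the gradient. First-order conditions yield
  \<open>w = 0\<close>, and comparison with other points of the sphere yields
  semidefiniteness.\<close>

lemma trs_minimizer_boundary_multiplier:
  fixes B :: "real^'n^'n"
  assumes B: "symmetric_mat B" and min: "trs_minimizer B b \<Delta> x"
    and x: "norm x = \<Delta>" and \<Delta>: "\<Delta> > 0"
  obtains lam where "trs_multiplier B b \<Delta> x lam"
proof -
  define G where "G = B *v x + b"
  have xx: "x \<bullet> x > 0"
    using x \<Delta> by auto
  have first: "0 \<le> G \<bullet> d" if "x \<bullet> d < 0" for d
    unfolding G_def using trs_minimizer_first_order[OF B min] that by blast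
  define lam where "lam = - (G \<bullet> x) / (x \<bullet> x)"
  have Gx: "G \<bullet> x \<le> 0"
    using first[of "- x"] xx by simp
  then have lam: "lam \<ge> 0"
    using xx by (simp add: lam_def divide_nonpos_pos)
  define w where "w = G + lam *\<^sub>R x"
  have wx: "w \<bullet> x = 0"
    using xx by (simp add: w_def lam_def inner_add_left inner_diff_left)
  have Gw: "G \<bullet> w = w \<bullet> w"
    using wx by (simp add: w_def inner_add_left inner_commute)
  \<comment> \<open>The direction \<open>- w\<close> is only tangent to the sphere, so
    \<open>first\<close> is applied to \<open>- w - t *\<^sub>R x\<close>, which points strictly
    inwards, and \<open>t\<close> tends to 0.\<close>
  have "0 \<le> - (w \<bullet> w)"
  proof (rule quadratic_constant_term_nonneg[of 1 _ "- (G \<bullet> x)" 0])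
    fix t :: real assume "0 < t"
    then have "x \<bullet> (- w - t *\<^sub>R x) < 0"
      using xx wx by (simp add: inner_diff_right inner_commute)
    from first[OF this] show "0 \<le> - (w \<bullet> w) + - (G \<bullet> x) * t + 0 * t\<^sup>2"
      using Gw by (simp add: inner_diff_right mult.commute)
  qed simp
  then have "w = 0"
    using inner_gt_zero_iff[of w] by linarith
  then have Geq: "G = - (lam *\<^sub>R x)"
    by (simp add: w_def eq_neg_iff_add_eq_0)
  let ?H = "B + mat lam"
  have H: "?H *v v = B *v v + lam *\<^sub>R v" for v
    by (simp add: matrix_vector_mult_add_rdistrib mat_mult_vec)
  \<comment> \<open>If \<open>v\<close> is not tangent to the sphere, the line through \<open>x\<close> along \<open>v\<close> meets it again,
    and there the objective exceeds that of \<open>x\<close> by a positive multiple of \<open>v \<bullet> (?H *v v)\<close>.\<close>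
  have trans: "0 \<le> v \<bullet> (?H *v v)" if vx: "v \<bullet> x \<noteq> 0" for v
  proof -
    have vv: "v \<bullet> v > 0"
      using vx by auto
    define \<tau> where "\<tau> = - 2 * (v \<bullet> x) / (v \<bullet> v)"
    have \<tau>: "\<tau> \<noteq> 0" "\<tau> * (v \<bullet> v) = - 2 * (v \<bullet> x)"
      using vx vv by (auto simp: \<tau>_def)
    have "(norm (x + \<tau> *\<^sub>R v))\<^sup>2 = x \<bullet> x + \<tau> * (2 * (v \<bullet> x) + \<tau> * (v \<bullet> v))"
      by (simp add: power2_norm_eq_inner inner_add_left inner_add_right inner_commute
          algebra_simps)
    also have "\<dots> = (norm x)\<^sup>2"
      by (simp add: \<tau>(2) power2_norm_eq_inner)
    finally have "norm (x + \<tau> *\<^sub>R v) = norm x"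
      by (simp only: power2_eq_iff_nonneg norm_ge_zero)
    then have "norm (x + \<tau> *\<^sub>R v) \<le> \<Delta>"
      using x by simp
    then have "trs_objective B b x \<le> trs_objective B b (x + \<tau> *\<^sub>R v)"
      using min by (simp add: trs_minimizer_def is_arg_min_linorder)
    then have "0 \<le> \<tau> * (G \<bullet> v) + 1/2 * (\<tau> * (\<tau> * (v \<bullet> (B *v v))))"
      unfolding trs_objective_add[OF B] G_def[symmetric]
      by (simp add: matrix_vector_mult_scaleR)
    \<comment> \<open>Since \<open>G\<close> is a multiple of \<open>x\<close>, the choice of
      \<open>\<tau>\<close> makes the linear term quadratic in \<open>\<tau>\<close>, and this
      supplies the \<open>lam\<close> part of \<open>?H\<close>.\<close>
    also have "G \<bullet> v = 1/2 * lam * (\<tau> * (v \<bullet> v))"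
      by (simp add: Geq \<tau>(2) inner_commute)
    finally have "0 \<le> \<tau>\<^sup>2 * (v \<bullet> (?H *v v))"
      unfolding H by (simp add: inner_add_right power2_eq_square field_simps)
    then show ?thesis
      using \<tau>(1) by (simp add: zero_le_mult_iff)
  qed
  have "0 \<le> v \<bullet> (?H *v v)" for v
  proof (cases "v \<bullet> x = 0")
    case True
    \<comment> \<open>A tangent direction \<open>v\<close> is the limit of the directions
      \<open>v + t *\<^sub>R x\<close>, to which \<open>trans\<close> applies.\<close>
    show ?thesis
    proof (rule quadratic_constant_term_nonneg[of 1 _
          "v \<bullet> (?H *v x) + x \<bullet> (?H *v v)" "x \<bullet> (?H *v x)"])
      fix t :: real assume "0 < t"
      then have "(v + t *\<^sub>R x) \<bullet> x \<noteq> 0"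
        using True xx by (simp add: inner_add_left)
      from trans[OF this]
      show "0 \<le> v \<bullet> (?H *v v) + (v \<bullet> (?H *v x) + x \<bullet> (?H *v v)) * t + x \<bullet> (?H *v x) * t\<^sup>2"
        by (simp add: matrix_vector_right_distrib matrix_vector_mult_scaleR inner_add_left
            inner_add_right algebra_simps power2_eq_square)
    qed simp
  qed (rule trans)
  moreover have "?H *v x = - b"
    unfolding H using Geq by (simp add: G_def eq_neg_iff_add_eq_0 algebra_simps)
  moreover have "symmetric_mat ?H"
    using B by auto
  ultimately have "trs_multiplier B b \<Delta> x lam"
    using x lam by (simp add: trs_multiplier_def pos_semidef_mat_def)
  then show thesis
    by (rule that)
qed

text \<open>Semidefiniteness tested on a bottom eigenvector gives
  \<open>lam \<ge> - min_eigenvalue B\<close>. In case of equality, \<open>lam \<ge> 0\<close> and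
  stationarity become exactly the situation that \<open>not_hard\<close> excludes.\<close>

lemma trs_easy_caseI:
  fixes B :: "real^'n^'n"
  assumes B: "symmetric_mat B" and \<Delta>: "\<Delta> > 0"
    and not_hard: "\<And>x. \<lbrakk>min_eigenvalue B \<le> 0; norm x \<le> \<Delta>\<rbrakk>
      \<Longrightarrow> B *v x + b \<noteq> min_eigenvalue B *\<^sub>R x"
  shows "trs_easy_case B b \<Delta>"
proof -
  obtain x where min: "trs_minimizer B b \<Delta> x"
    using trs_minimizer_exists[OF \<Delta>] .
  then have "norm x \<le> \<Delta>"
    by (simp add: trs_minimizer_def is_arg_min_linorder)
  then obtain lam where lam: "trs_multiplier B b \<Delta> x lam"
    using trs_minimizer_interior_multiplier[OF B min]
      trs_minimizer_boundary_multiplier[OF B min _ \<Delta>] by force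
  obtain v where v: "B *v v = min_eigenvalue B *\<^sub>R v" "v \<noteq> 0"
    using min_eigenvalue_in[OF B] by (auto simp: eigenvalues_def eigenspace_def)
  have "0 \<le> v \<bullet> ((B + mat lam) *v v)"
    using lam by (auto simp: trs_multiplier_def pos_semidef_mat_def)
  also have "\<dots> = (min_eigenvalue B + lam) * (v \<bullet> v)"
    by (simp add: matrix_vector_mult_add_rdistrib mat_mult_vec v algebra_simps)
  finally have "0 \<le> (min_eigenvalue B + lam) * (v \<bullet> v)" .
  moreover have "v \<bullet> v > 0"
    using v by simp
  ultimately have "0 \<le> min_eigenvalue B + lam"
    by (simp add: zero_le_mult_iff del: inner_gt_zero_iff)
  moreover have "lam \<noteq> - min_eigenvalue B"
  proof
    assume eq: "lam = - min_eigenvalue B"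
    then have "min_eigenvalue B \<le> 0" "B *v x + b = min_eigenvalue B *\<^sub>R x"
      using lam unfolding trs_multiplier_def eq matrix_vector_mult_add_rdistrib mat_mult_vec
      by (auto simp: algebra_simps)
    with not_hard \<open>norm x \<le> \<Delta>\<close> show False
      by blast
  qed
  ultimately have "lam > - min_eigenvalue B"
    by linarith
  with min lam show ?thesis
    unfolding trs_easy_case_def by blast
qed

section \<open>Estimates forced by the hard case\<close>

text \<open>With \<open>c = \<beta> - a\<close>, the vector bounded here equals
  \<open>(A - mat a) *v x + g\<close> whenever the hard-case equation for the perturbed data
  holds.\<close>

lemma hard_case_residual_le:
  fixes F :: "real^'n^'n"
  assumes x: "norm x \<le> \<Delta>"
    and t: "\<bar>c\<bar> \<le> t" "spectral_norm F \<le> t" "norm f \<le> t"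
  shows "norm (c *\<^sub>R x - F *v x - f) \<le> t * (2 * \<Delta> + 1)"
proof -
  have t0: "t \<ge> 0"
    using t by linarith
  have "norm (c *\<^sub>R x) \<le> t * \<Delta>"
    using x t t0 by (simp add: mult_mono)
  moreover have "norm (F *v x) \<le> t * \<Delta>"
  proof -
    have "spectral_norm F * norm x \<le> t * \<Delta>"
      using x t t0 by (intro mult_mono) auto
    then show ?thesis
      using spectral_norm_bound[of F x] by linarith
  qed
  ultimately show ?thesis
    using norm_triangle_ineq4[of "c *\<^sub>R x - F *v x" f]
      norm_triangle_ineq4[of "c *\<^sub>R x" "F *v x"] t(3)
    by (simp add: algebra_simps)
qed

lemma hard_case_eigenspace_component_le:
  fixes A F :: "real^'n^'n" and U :: "real^'s^'n"
  assumes A: "symmetric_mat A" and U: "orthonormal_basis_mat U (eigenspace A a)"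
    and x: "(A + F) *v x + (g + f) = \<beta> *\<^sub>R x" "norm x \<le> \<Delta>"
    and t: "\<bar>\<beta> - a\<bar> \<le> t" "spectral_norm F \<le> t" "norm f \<le> t"
  shows "norm (transpose U *v g) \<le> t * (2 * \<Delta> + 1)"
proof -
  define h where "h = (\<beta> - a) *\<^sub>R x - F *v x - f"
  have UU: "transpose U ** U = mat 1"
    using U by (simp add: orthonormal_basis_mat_def)
  \<comment> \<open>Transposing \<open>A ** U = a *\<^sub>R U\<close> and using the symmetry of
    \<open>A\<close> shows that \<open>transpose U\<close> annihilates the range of
    \<open>A - mat a\<close>.\<close>
  have "transpose (A ** U) = a *\<^sub>R transpose U"
    unfolding orthonormal_basis_mat_eigenspace[OF U] by (simp add: transpose_def vec_eq_iff)
  then have UA: "transpose U *v (A *v x) = a *\<^sub>R (transpose U *v x)"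
    using A by (simp add: matrix_transpose_mul symmetric_mat_def matrix_vector_mul_assoc
        scaleR_matrix_vector_assoc del: transpose_matrix_vector)
  have "g = h - (A *v x - a *\<^sub>R x)"
    using x(1) by (simp add: h_def algebra_simps)
  then have "transpose U *v g
      = transpose U *v h - (transpose U *v (A *v x) - a *\<^sub>R (transpose U *v x))"
    by (simp only: matrix_vector_mult_diff_distrib matrix_vector_mult_scaleR)
  then have "transpose U *v g = transpose U *v h"
    by (simp only: UA diff_self diff_zero)
  then have "norm (transpose U *v g) \<le> norm h"
    using norm_transpose_orthonormal_mult_le[OF UU] by simp
  also have "\<dots> \<le> t * (2 * \<Delta> + 1)"
    unfolding h_def by (rule hard_case_residual_le) (use x t in auto)
  finally show ?thesis .
qed

text \<open>Write \<open>g = h - M *v x\<close> and apply \<open>X\<close>. Since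
  \<open>X ** M\<close> is an orthogonal projection, the second term has norm at most
  \<open>\<Delta>\<close>. The vector \<open>X *v h\<close> is orthogonal to the kernel of
  \<open>M\<close>, so the gap gives
  \<open>\<delta> * norm (X *v h) \<le> norm (M *v (X *v h))\<close>, and \<open>M ** X\<close> is
  again a projection.\<close>

lemma hard_case_moore_penrose_le:
  fixes A F :: "real^'n^'n" and U :: "real^'s^'n"
  assumes A: "symmetric_mat A" and U: "orthonormal_basis_mat U (eigenspace A a)"
    and gap: "\<And>\<mu>. \<mu> \<in> eigenvalues A \<Longrightarrow> \<mu> \<noteq> a \<Longrightarrow> a + \<delta> \<le> \<mu>" and \<delta>: "\<delta> > 0"
    and x: "(A + F) *v x + (g + f) = \<beta> *\<^sub>R x" "norm x \<le> \<Delta>"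
    and t: "\<bar>\<beta> - a\<bar> \<le> t" "spectral_norm F \<le> t" "norm f \<le> t"
  shows "\<delta> * (norm (moore_penrose (A - mat a) *v g) - \<Delta>) \<le> t * (2 * \<Delta> + 1)"
proof -
  define h where "h = (\<beta> - a) *\<^sub>R x - F *v x - f"
  define M where "M = A - mat a"
  define X where "X = moore_penrose M"
  have M: "symmetric_mat M"
    unfolding M_def using A by auto
  have ker: "eigenspace A a = eigenspace M 0"
    by (auto simp: eigenspace_def M_def matrix_vector_mult_diff_rdistrib mat_mult_vec)
  have mp: "is_moore_penrose M X"
    unfolding X_def using is_moore_penrose_moore_penrose[OF M] U ker by simp
  then have XMX: "X ** M ** X = X" and MXM: "M ** X ** M = M"
    and MX: "symmetric_mat (M ** X)" and XM: "symmetric_mat (X ** M)"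
    by (auto simp: is_moore_penrose_def)
  have contr: "norm (M *v (X *v y)) \<le> norm y" "norm (X *v (M *v y)) \<le> norm y" for y
    using norm_symmetric_idempotent_le[OF MX] norm_symmetric_idempotent_le[OF XM] XMX MXM
    by (simp_all add: matrix_vector_mul_assoc matrix_mul_assoc)
  \<comment> \<open>Insert the symmetric factor \<open>X ** M\<close> in front of \<open>X\<close>
    and move it to \<open>v\<close>, which \<open>M\<close> annihilates.\<close>
  have orth: "v \<bullet> (X *v y) = 0" if "v \<in> eigenspace A a" for v y
  proof -
    have "v \<bullet> (X *v y) = v \<bullet> ((X ** M) *v (X *v y))"
      by (simp add: matrix_vector_mul_assoc XMX)
    also have "\<dots> = (X *v (M *v v)) \<bullet> (X *v y)"
      unfolding symmetric_mat_inner[OF XM] by (simp add: matrix_vector_mul_assoc)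
    also have "M *v v = 0"
      using that unfolding ker by (simp add: eigenspace_def)
    finally show ?thesis
      by simp
  qed
  have "g = h - M *v x"
    using x(1) by (simp add: M_def h_def mat_mult_vec algebra_simps)
  then have "norm (X *v g) = norm (X *v h - X *v (M *v x))"
    by (metis matrix_vector_mult_diff_distrib)
  also have "\<dots> \<le> norm (X *v h) + norm (X *v (M *v x))"
    by (rule norm_triangle_ineq4)
  also have "\<dots> \<le> norm (X *v h) + \<Delta>"
    using contr(2)[of x] x(2) by linarith
  finally have "\<delta> * (norm (X *v g) - \<Delta>) \<le> \<delta> * norm (X *v h)"
    using \<delta> by (intro mult_left_mono) auto
  also have "\<dots> \<le> norm (M *v (X *v h))"
    unfolding M_def by (rule norm_ge_gap_on_orthogonal_complement[OF A gap orth])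
  also have "\<dots> \<le> norm h"
    by (rule contr)
  also have "\<dots> \<le> t * (2 * \<Delta> + 1)"
    unfolding h_def by (rule hard_case_residual_le) (use x t in auto)
  finally show ?thesis
    by (simp add: X_def M_def)
qed

section \<open>The easy case under perturbation\<close>

theorem theorem2p3:
  fixes A E :: "real^'n^'n"
    and g e :: "real^'n"
    and U2 :: "real^'s^'n"
    and \<Delta> \<epsilon> \<eta>1 \<eta>2 :: real
    and \<alpha> :: "nat \<Rightarrow> real"
    and n s :: nat
  assumes n: "n = CARD('n)" and s: "s = CARD('s)" and sn: "1 \<le> s" "s < n"
    and A: "symmetric_mat A" and E: "symmetric_mat E"
    and g: "g \<noteq> 0" and \<Delta>: "\<Delta> > 0"
    and eigs: "ordered_eigenvalues A \<alpha>"
    and gap: "\<alpha> (n - s) > \<alpha> (n - s + 1)"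
    and mult: "\<forall>i\<in>{n - s + 1..n}. \<alpha> i = \<alpha> n"
    and U2: "orthonormal_basis_mat U2 (eigenspace A (\<alpha> n))"
    and \<eta>1: "\<eta>1 = 1/2 * min
        ((\<alpha> (n - s) - \<alpha> n) * (norm (moore_penrose (A - mat (\<alpha> n)) *v g) - \<Delta>)
          / (3/2 * norm (moore_penrose (A - mat (\<alpha> n)) *v g) + 1
              + cos_angle g U2 * norm g / (\<alpha> (n - s) - \<alpha> n)))
        (\<alpha> (n - s) - \<alpha> n)"
    and \<eta>2: "\<eta>2 = 1/2 * min
        (norm ((U2 ** transpose U2) *v g) * (\<alpha> (n - s) - \<alpha> n)
          / (4 * norm g + (\<alpha> (n - s) - \<alpha> n)))
        (min (norm g * cos_angle g U2 / (2 * \<Delta>)) (\<alpha> (n - s) - \<alpha> n))"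
    and easy: "trs_easy_case A g \<Delta>"
  shows "(0 < max (spectral_norm (\<epsilon> *\<^sub>R E)) (norm (\<epsilon> *\<^sub>R e)) \<and>
          max (spectral_norm (\<epsilon> *\<^sub>R E)) (norm (\<epsilon> *\<^sub>R e)) < max \<eta>1 \<eta>2 \<longrightarrow>
            trs_easy_case (A + \<epsilon> *\<^sub>R E) (g + \<epsilon> *\<^sub>R e) \<Delta>) \<and>
         (pos_def_mat A \<and> 0 < spectral_norm (\<epsilon> *\<^sub>R E) \<and> spectral_norm (\<epsilon> *\<^sub>R E) < \<alpha> n \<longrightarrow>
            trs_easy_case (A + \<epsilon> *\<^sub>R E) (g + \<epsilon> *\<^sub>R e) \<Delta>)"
proof -
  let ?F = "\<epsilon> *\<^sub>R E" and ?f = "\<epsilon> *\<^sub>R e"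
  let ?B = "A + ?F" and ?b = "g + ?f"
  define a where "a = \<alpha> n"
  define \<delta> where "\<delta> = \<alpha> (n - s) - a"
  define t where "t = max (spectral_norm ?F) (norm ?f)"
  define N where "N = norm (moore_penrose (A - mat a) *v g)"
  define p where "p = norm (transpose U2 *v g)"
  define \<beta> where "\<beta> = min_eigenvalue ?B"
  have F: "symmetric_mat ?F" and B: "symmetric_mat ?B"
    using A E by auto
  have U2': "orthonormal_basis_mat U2 (eigenspace A a)"
    using U2 by (simp add: a_def)
  have a_min: "min_eigenvalue A = a"
    unfolding a_def n by (rule min_eigenvalue_ordered_eigenvalues[OF eigs])
  have \<beta>a: "\<bar>\<beta> - a\<bar> \<le> spectral_norm ?F"
    using min_eigenvalue_perturbation[OF A F] by (simp add: \<beta>_def a_min)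
  \<comment> \<open>As \<open>1 \<le> s\<close>, the index \<open>n - s + 1\<close> is at most
    \<open>n\<close> and belongs to the lowest block.\<close>
  have "\<alpha> (n - s + 1) = a"
    unfolding a_def by (rule bspec[OF mult]) (use sn in auto)
  then have \<delta>: "\<delta> > 0"
    using gap by (simp add: \<delta>_def)
  have gapA: "a + \<delta> \<le> \<mu>" if \<mu>: "\<mu> \<in> eigenvalues A" "\<mu> \<noteq> a" for \<mu>
  proof -
    obtain i where i: "i \<in> {1..n}" "\<mu> = \<alpha> i"
      using \<mu>(1) eigenvalues_eq_ordered_eigenvalues[OF eigs] n by auto
    then have "i \<notin> {n - s + 1..n}"
      using i \<mu>(2) mult a_def by metis
    \<comment> \<open>Monotonicity is available only on \<open>{1..n}\<close>; \<open>s < n\<close>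
      puts \<open>n - s\<close> in that range.\<close>
    then have "i \<le> n - s" "n - s \<in> {1..n}"
      using sn i by auto
    then have "\<alpha> (n - s) \<le> \<alpha> i"
      using eigs i n unfolding ordered_eigenvalues_def monotone_on_def by blast
    then show ?thesis
      by (simp add: i \<delta>_def)
  qed
  \<comment> \<open>The cosine and projection terms in both thresholds are all expressed through the
    single quantity \<open>p\<close>.\<close>
  have p_cos: "cos_angle g U2 * norm g = p" "norm g * cos_angle g U2 = p"
    using g by (simp_all add: cos_angle_def p_def)
  have p_proj: "norm ((U2 ** transpose U2) *v g) = p"
    using norm_orthonormal_mult[of U2] U2
    by (simp add: orthonormal_basis_mat_def p_def flip: matrix_vector_mul_assoc)
  have nonneg: "p \<ge> 0" "N \<ge> 0"
    by (simp_all add: p_def N_def)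
  have "t \<ge> 0"
    by (simp add: t_def le_max_iff_disj)

  have easy1: "trs_easy_case ?B ?b \<Delta>" if lt: "t < max \<eta>1 \<eta>2"
  proof (rule trs_easy_caseI[OF B \<Delta>], rule notI)
    fix x assume x: "norm x \<le> \<Delta>" "?B *v x + ?b = min_eigenvalue ?B *\<^sub>R x"
    have t: "\<bar>\<beta> - a\<bar> \<le> t" "spectral_norm ?F \<le> t" "norm ?f \<le> t"
      using \<beta>a by (auto simp: t_def)
    note x' = x(2)[folded \<beta>_def]
    have double: "2 * t < m" if "t < 1/2 * m" for m
      using that by linarith
    show False
    proof (cases "t < \<eta>1")
      case True
      let ?D = "3/2 * N + 1 + p / \<delta>"
      have D: "?D \<ge> 3/2 * N + 1" "?D > 0"
        using nonneg \<delta> by (auto intro: add_pos_nonneg)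
      have "2 * t < min (\<delta> * (N - \<Delta>) / ?D) \<delta>"
        using True unfolding \<eta>1 p_cos a_def[symmetric] \<delta>_def[symmetric] N_def[symmetric]
        by (rule double)
      then have lower: "2 * t * ?D < \<delta> * (N - \<Delta>)"
        by (simp only: min_less_iff_conj pos_less_divide_eq[OF D(2)])
      moreover have "0 \<le> 2 * t * ?D"
        using \<open>t \<ge> 0\<close> D by simp
      \<comment> \<open>The sign of the numerator of \<open>\<eta>1\<close> allows
        \<open>\<Delta>\<close> to be replaced by \<open>N\<close>: then
        \<open>2 * \<Delta> + 1 < 2 * N + 1 \<le> 3 * N + 2 \<le> 2 * ?D\<close>.\<close>
      ultimately have "N > \<Delta>"
        using \<delta> by (smt (verit) mult_nonneg_nonpos)
      then have "t * (2 * \<Delta> + 1) \<le> t * (2 * ?D)"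
        using \<open>t \<ge> 0\<close> D by (intro mult_left_mono) auto
      moreover have "\<delta> * (N - \<Delta>) \<le> t * (2 * \<Delta> + 1)"
        unfolding N_def by (rule hard_case_moore_penrose_le[OF A U2' gapA \<delta> x' x(1) t])
      ultimately show False
        using lower by (simp add: algebra_simps)
    next
      case False
      then have lt2: "t < \<eta>2"
        using lt by simp
      have "2 * t < min (p * \<delta> / (4 * norm g + \<delta>)) (min (p / (2 * \<Delta>)) \<delta>)"
        using lt2 unfolding \<eta>2 p_cos p_proj a_def[symmetric] \<delta>_def[symmetric]
        by (rule double)
      then have "2 * t < p / (2 * \<Delta>)" "2 * t < p * \<delta> / (4 * norm g + \<delta>)"
        by simp_all
      \<comment> \<open>The first entry of the minimum thus gives \<open>t < p / 2\<close> and the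
        second \<open>2 * t * \<Delta> < p / 2\<close>; their sum contradicts the eigenspace
        estimate.\<close>
      moreover have "p * \<delta> / (4 * norm g + \<delta>) \<le> p"
        using nonneg \<delta> by (simp add: divide_le_eq add_nonneg_pos distrib_left)
      ultimately have "2 * t * \<Delta> < p / 2" "t < p / 2"
        using \<Delta> by (auto simp: field_simps)
      moreover have "p \<le> t * (2 * \<Delta> + 1)"
        unfolding p_def by (rule hard_case_eigenspace_component_le[OF A U2' x' x(1) t])
      ultimately show False
        by (simp add: algebra_simps)
    qed
  qed
  \<comment> \<open>By Weyl's inequality the smallest eigenvalue of \<open>?B\<close> stays
    positive, whereas the hard case needs it to be at most 0.\<close>
  have easy2: "trs_easy_case ?B ?b \<Delta>" if lt: "spectral_norm ?F < \<alpha> n"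
  proof (rule trs_easy_caseI[OF B \<Delta>])
    fix x assume "min_eigenvalue ?B \<le> 0"
    with lt \<beta>a show "?B *v x + ?b \<noteq> min_eigenvalue ?B *\<^sub>R x"
      by (simp add: \<beta>_def a_def)
  qed
  show ?thesis
    using easy1 easy2 unfolding t_def by blast
qed

end
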